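(* Fix a constant $\overline{\rho}<1/2$. Let $A\in\mathbb{Q}^{n\times n}$ be nonsingular with $\rho(|A^{-1}|)\le\overline{\rho}$, let $b\in\mathbb{Q}^n$, write $A=\bar A/d_A$, $b=\bar b/d_b$ with $\bar A\in\mathbb{Z}^{n\times n}$, $\bar b\in\mathbb{Z}^n$, $d_A,d_b\in\mathbb{Z}_{>0}$, and let $L=\max\{d_b,d_A,\|\bar b\|_\infty,\|\bar A\|_{\max}\}$. Then the generalized Newton method (GNM), applied directly to the absolute value equation $Ax-|x|=b$ (without preconditioning), finds its unique solution in $\mathcal{O}(n^2\log(nL))$ iterations.
   Context: $|X|$ and $|x|$ are entrywise; $\rho(\cdot)$ is the spectral radius; $\|\cdot\|_\infty$ for vectors is the maximum absolute entry; $\|X\|_{\max}=\max_{i,j}|X_{ij}|$. For $z\in\{-1,1\}^n$ write $Z=\operatorname{Diag}(z)$; $A-Z$ is nonsingular for all such $z$ under the stated condition. GNM (full-flip algorithm): initialize $z\in\{-1,1\}^n$; compute $x=(A-Z)^{-1}b$ and the mismatch set $\mathcal{V}_z=\{i\in\{1,\dots,n\}: z_ix_i<0\}$. While $\mathcal{V}_z\neq\emptyset$: replace $z_i$ by $-z_i$ for all $i\in\mathcal{V}_z$; recompute $Z$, $x=(A-Z)^{-1}b$ and $\mathcal{V}_z$. When $\mathcal{V}_z=\emptyset$, return $x$. One pass through the while loop is one iteration. The constant implied by $\mathcal{O}$ depends only on the fixed constant $\overline{\rho}$. *)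

theory Defs
  imports
    "Jordan_Normal_Form.Spectral_Radius"
    "Jordan_Normal_Form.Gauss_Jordan_Elimination"
begin

definition abs_mat :: "real mat \<Rightarrow> real mat" where
  "abs_mat X = map_mat abs X"

definition abs_vec :: "real vec \<Rightarrow> real vec" where
  "abs_vec x = map_vec abs x"

(* mat_inverse returns None exactly on singular or non-square input; the value is then arbitrary,
   so every use below is accompanied by a nonsingularity condition. *)
definition inv_mat :: "real mat \<Rightarrow> real mat" where
  "inv_mat X = the (mat_inverse X)"

(* The library's spectral radius is defined on complex matrices only. *)
definition real_spectral_radius :: "real mat \<Rightarrow> real" where
  "real_spectral_radius X = spectral_radius (map_mat complex_of_real X)"

definition is_ave_solution :: "real mat \<Rightarrow> real vec \<Rightarrow> real vec \<Rightarrow> bool" where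
  "is_ave_solution A b x \<longleftrightarrow> x \<in> carrier_vec (dim_col A) \<and> A *\<^sub>v x - abs_vec x = b"

definition sign_vecs :: "nat \<Rightarrow> real vec set" where
  "sign_vecs n = {z \<in> carrier_vec n. \<forall>i<n. z $ i \<in> {-1, 1}}"

definition Diag :: "real vec \<Rightarrow> real mat" where
  "Diag z = mat_diag (dim_vec z) (\<lambda>i. z $ i)"

definition gnm_point :: "real mat \<Rightarrow> real vec \<Rightarrow> real vec \<Rightarrow> real vec" where
  "gnm_point A b z = inv_mat (A - Diag z) *\<^sub>v b"

definition mismatch :: "real vec \<Rightarrow> real vec \<Rightarrow> nat set" where
  "mismatch z x = {i. i < dim_vec z \<and> z $ i * x $ i < 0}"

definition flip :: "nat set \<Rightarrow> real vec \<Rightarrow> real vec" where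
  "flip V z = vec (dim_vec z) (\<lambda>i. if i \<in> V then - (z $ i) else z $ i)"

(* gnm_run A b z k x: started from the sign vector z, the full-flip algorithm encounters only
   nonsingular matrices, leaves the while loop after exactly k passes, and returns x.
   For given A, b and z there is at most one such pair (k, x), and none if the loop runs forever. *)
inductive gnm_run :: "real mat \<Rightarrow> real vec \<Rightarrow> real vec \<Rightarrow> nat \<Rightarrow> real vec \<Rightarrow> bool"
  for A :: "real mat" and b :: "real vec" where
  stop: "invertible_mat (A - Diag z) \<Longrightarrow> x = gnm_point A b z \<Longrightarrow> mismatch z x = {} \<Longrightarrow>
    gnm_run A b z 0 x"
| step: "invertible_mat (A - Diag z) \<Longrightarrow> x = gnm_point A b z \<Longrightarrow> mismatch z x \<noteq> {} \<Longrightarrow>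
    gnm_run A b (flip (mismatch z x) z) k y \<Longrightarrow> gnm_run A b z (Suc k) y"

definition vec_inf_norm :: "int vec \<Rightarrow> int" where
  "vec_inf_norm v = Max (abs ` set\<^sub>v v)"

definition mat_max_norm :: "int mat \<Rightarrow> int" where
  "mat_max_norm X = Max (abs ` elements_mat X)"

definition data_size :: "int mat \<Rightarrow> int \<Rightarrow> int vec \<Rightarrow> int \<Rightarrow> int" where
  "data_size A' dA b' db = Max {db, dA, vec_inf_norm b', mat_max_norm A'}"

end

theory Submission
  imports Defs
begin

text \<open>In fact at most \<open>n\<close> iterations suffice. Put \<open>B = A\<^sup>-\<^sup>1\<close> and \<open>c = B b\<close>, and choose weights \<open>v > 0\<close> with
  \<open>|B| v \<le> r v\<close> for some \<open>r < 1/2\<close>. Every iterate satisfies \<open>x = c + B Z x\<close>, so in the weighted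
  maximum norm \<open>\<parallel>x - c\<parallel> \<le> r / (1 - r) \<parallel>c\<parallel> < \<parallel>c\<parallel>\<close> unless \<open>c = 0\<close>. Hence an index maximizing
  \<open>|c\<^sub>i| / v\<^sub>i\<close> has the sign of \<open>c\<^sub>i\<close> in every iterate, and \<open>z\<^sub>i\<close> is correct after one
  pass. Eliminating this index preserves the weighted bound, and induction finishes the proof.
  Since \<open>n L \<ge> 2\<close>, the number \<open>n\<close> is at most \<open>n\<^sup>2 ln (n L) / ln 2\<close>.\<close>

section \<open>Sign stability and elimination in a weighted maximum norm\<close>

text \<open>At an index \<open>k\<close> where \<open>\<bar>y k\<bar> / v k\<close> attains its
  maximum \<open>X\<close>, the hypotheses give \<open>X * v k \<le> a * v k + r * X * v k\<close>,
  hence \<open>X \<le> a / (1 - r)\<close>. The case \<open>a = 0\<close> forces \<open>y\<close> to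
  vanish.\<close>

lemma weighted_bound:
  fixes S :: "'a \<Rightarrow> 'a \<Rightarrow> real" and v y :: "'a \<Rightarrow> real"
  assumes fin: "finite I" and r: "r < 1"
    and v: "\<And>i. i \<in> I \<Longrightarrow> v i > 0"
    and S: "\<And>i. i \<in> I \<Longrightarrow> (\<Sum>j\<in>I. \<bar>S i j\<bar> * v j) \<le> r * v i"
    and y: "\<And>i. i \<in> I \<Longrightarrow> \<bar>y i\<bar> \<le> a * v i + (\<Sum>j\<in>I. \<bar>S i j\<bar> * \<bar>y j\<bar>)"
    and i: "i \<in> I"
  shows "\<bar>y i\<bar> \<le> a / (1 - r) * v i"
proof -
  define X where "X = Max ((\<lambda>i. \<bar>y i\<bar> / v i) ` I)"
  have "X \<in> (\<lambda>i. \<bar>y i\<bar> / v i) ` I"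
    unfolding X_def using fin i by (intro Max_in) auto
  then obtain k where k: "k \<in> I" and Xk: "X = \<bar>y k\<bar> / v k" by auto
  have le: "\<bar>y j\<bar> \<le> X * v j" if "j \<in> I" for j
  proof -
    have "\<bar>y j\<bar> / v j \<le> X" unfolding X_def using fin that by (intro Max_ge) auto
    then show ?thesis using v[OF that] by (simp add: field_simps)
  qed
  have X0: "X \<ge> 0" unfolding Xk using v[OF k] by simp
  have "X * v k = \<bar>y k\<bar>" unfolding Xk using v[OF k] by simp
  also have "\<dots> \<le> a * v k + (\<Sum>j\<in>I. \<bar>S k j\<bar> * \<bar>y j\<bar>)" by (rule y[OF k])
  also have "(\<Sum>j\<in>I. \<bar>S k j\<bar> * \<bar>y j\<bar>) \<le> (\<Sum>j\<in>I. \<bar>S k j\<bar> * (X * v j))"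
    by (intro sum_mono mult_left_mono le) auto
  also have "\<dots> = X * (\<Sum>j\<in>I. \<bar>S k j\<bar> * v j)" by (simp add: sum_distrib_left mult_ac)
  also have "\<dots> \<le> X * (r * v k)" by (intro mult_left_mono S[OF k] X0)
  finally have "v k * (X * (1 - r)) \<le> v k * a" by (simp add: algebra_simps)
  then have "X * (1 - r) \<le> a" using v[OF k] by simp
  then have "X \<le> a / (1 - r)" using r by (simp add: field_simps)
  then show ?thesis using le[OF i] v[OF i] by (meson mult_right_mono less_imp_le order_trans)
qed

text \<open>The previous bound applied to \<open>x\<close> gives
  \<open>\<bar>x i - c i\<bar> \<le> r / (1 - r) * \<bar>c i\<bar>\<close>, and
  \<open>r / (1 - r) < 1\<close> holds exactly because \<open>r < 1 / 2\<close>. The perturbation is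
  thus too small to change the sign of \<open>c i\<close>; if \<open>c i = 0\<close>, it forces
  \<open>x i = 0\<close>.\<close>

lemma sign_of_dominant_entry:
  fixes S :: "'a \<Rightarrow> 'a \<Rightarrow> real" and c v x z :: "'a \<Rightarrow> real"
  assumes fin: "finite I" and r: "0 \<le> r" "r < 1 / 2"
    and v: "\<And>i. i \<in> I \<Longrightarrow> v i > 0"
    and S: "\<And>i. i \<in> I \<Longrightarrow> (\<Sum>j\<in>I. \<bar>S i j\<bar> * v j) \<le> r * v i"
    and x: "\<And>i. i \<in> I \<Longrightarrow> x i = c i + (\<Sum>j\<in>I. S i j * (z j * x j))"
    and z: "\<And>i. i \<in> I \<Longrightarrow> \<bar>z i\<bar> = 1"
    and i: "i \<in> I" and dom: "\<And>j. j \<in> I \<Longrightarrow> \<bar>c j\<bar> / v j \<le> \<bar>c i\<bar> / v i"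
  shows "sgn (x i) = sgn (c i)"
proof -
  define m where "m = \<bar>c i\<bar> / v i"
  have m0: "m \<ge> 0" unfolding m_def using v[OF i] by simp
  have cm: "\<bar>c j\<bar> \<le> m * v j" if "j \<in> I" for j
    using dom[OF that] v[OF that] unfolding m_def[symmetric] by (simp add: field_simps)
  have abs_sum: "\<bar>\<Sum>j\<in>I. S k j * (z j * x j)\<bar> \<le> (\<Sum>j\<in>I. \<bar>S k j\<bar> * \<bar>x j\<bar>)" for k
    by (rule order_trans[OF sum_abs]) (auto simp: abs_mult z intro!: sum_mono)
  have bd: "\<bar>x j\<bar> \<le> m / (1 - r) * v j" if "j \<in> I" for j
  proof (rule weighted_bound[where S = S and I = I and y = x and v = v and a = m])
    show "\<bar>x k\<bar> \<le> m * v k + (\<Sum>j\<in>I. \<bar>S k j\<bar> * \<bar>x j\<bar>)" if "k \<in> I" for k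
      using x[OF that] cm[OF that] abs_sum[of k] by linarith
  qed (use fin r v S that in auto)
  have q: "m / (1 - r) \<ge> 0" using m0 r by simp
  have "\<bar>x i - c i\<bar> \<le> (\<Sum>j\<in>I. \<bar>S i j\<bar> * \<bar>x j\<bar>)" using x[OF i] abs_sum[of i] by simp
  also have "\<dots> \<le> (\<Sum>j\<in>I. \<bar>S i j\<bar> * (m / (1 - r) * v j))"
    by (intro sum_mono mult_left_mono bd) auto
  also have "\<dots> = m / (1 - r) * (\<Sum>j\<in>I. \<bar>S i j\<bar> * v j)"
    by (simp add: sum_distrib_left mult_ac)
  also have "\<dots> \<le> m / (1 - r) * (r * v i)" by (intro mult_left_mono S[OF i] q)
  also have "\<dots> = r / (1 - r) * \<bar>c i\<bar>" unfolding m_def using v[OF i] by simp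
  finally have d: "\<bar>x i - c i\<bar> \<le> r / (1 - r) * \<bar>c i\<bar>" .
  show ?thesis
  proof (cases "c i = 0")
    case True
    then show ?thesis using d by simp
  next
    case False
    have "r / (1 - r) < 1" using r by (simp add: field_simps)
    then have "\<bar>x i - c i\<bar> < \<bar>c i\<bar>"
      using d False by (smt (verit) mult_less_cancel_right2 zero_less_abs_iff)
    then show ?thesis by (auto simp: sgn_real_def split: if_splits)
  qed
qed

text \<open>Eliminating an index whose sign is known does not increase the weighted norm, because
  \<open>(r - t) / (1 - t) \<le> r\<close> for \<open>0 \<le> t < 1\<close> and \<open>r \<le> 1\<close>.\<close>

lemma weighted_norm_eliminate:
  fixes S :: "'a \<Rightarrow> 'a \<Rightarrow> real" and v :: "'a \<Rightarrow> real"
  assumes fin: "finite I" and r: "0 \<le> r" "r < 1"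
    and v: "\<And>i. i \<in> I \<Longrightarrow> v i > 0"
    and S: "\<And>i. i \<in> I \<Longrightarrow> (\<Sum>j\<in>I. \<bar>S i j\<bar> * v j) \<le> r * v i"
    and i: "i \<in> I" and k: "k \<in> I" and \<sigma>: "\<bar>\<sigma>\<bar> = 1"
  shows "(\<Sum>j\<in>I - {i}. \<bar>S k j + S k i * \<sigma> * S i j / (1 - S i i * \<sigma>)\<bar> * v j) \<le> r * v k"
proof -
  define s where "s = \<bar>S i i\<bar>"
  have split: "(\<Sum>j\<in>I. \<bar>S l j\<bar> * v j) = \<bar>S l i\<bar> * v i + (\<Sum>j\<in>I - {i}. \<bar>S l j\<bar> * v j)" for l
    by (simp add: sum.remove[OF fin i])
  have nn: "0 \<le> (\<Sum>j\<in>I - {i}. \<bar>S i j\<bar> * v j)"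
    using v by (intro sum_nonneg mult_nonneg_nonneg) (auto simp: less_imp_le)
  have "s * v i \<le> r * v i" using S[OF i] nn split[of i] unfolding s_def by linarith
  then have sr: "s \<le> r" using v[OF i] by simp
  have den: "1 - s \<le> \<bar>1 - S i i * \<sigma>\<bar>"
  proof -
    have "\<bar>S i i * \<sigma>\<bar> = s" unfolding s_def using \<sigma> by (simp add: abs_mult)
    then show ?thesis by linarith
  qed
  have s1: "1 - s > 0" using sr r by simp
  have summand: "\<bar>S k i * \<sigma> * S i j / (1 - S i i * \<sigma>)\<bar> \<le> \<bar>S k i\<bar> / (1 - s) * \<bar>S i j\<bar>" for j
  proof -
    have "\<bar>S k i * \<sigma> * S i j / (1 - S i i * \<sigma>)\<bar> = \<bar>S k i\<bar> * \<bar>S i j\<bar> / \<bar>1 - S i i * \<sigma>\<bar>"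
      using \<sigma> by (simp add: abs_mult)
    also have "\<dots> \<le> \<bar>S k i\<bar> * \<bar>S i j\<bar> / (1 - s)"
      using den s1 by (intro divide_left_mono) auto
    finally show ?thesis by simp
  qed
  have "(\<Sum>j\<in>I - {i}. \<bar>S k j + S k i * \<sigma> * S i j / (1 - S i i * \<sigma>)\<bar> * v j)
      \<le> (\<Sum>j\<in>I - {i}. (\<bar>S k j\<bar> + \<bar>S k i\<bar> / (1 - s) * \<bar>S i j\<bar>) * v j)"
  proof (intro sum_mono mult_right_mono)
    fix j assume "j \<in> I - {i}"
    then show "0 \<le> v j" using v by (simp add: less_imp_le)
    show "\<bar>S k j + S k i * \<sigma> * S i j / (1 - S i i * \<sigma>)\<bar> \<le> \<bar>S k j\<bar> + \<bar>S k i\<bar> / (1 - s) * \<bar>S i j\<bar>"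
      using summand[of j] abs_triangle_ineq[of "S k j" "S k i * \<sigma> * S i j / (1 - S i i * \<sigma>)"] by linarith
  qed
  also have "\<dots> = (\<Sum>j\<in>I - {i}. \<bar>S k j\<bar> * v j)
      + \<bar>S k i\<bar> / (1 - s) * (\<Sum>j\<in>I - {i}. \<bar>S i j\<bar> * v j)"
    by (simp add: sum.distrib sum_distrib_left algebra_simps)
  also have "\<dots> \<le> (r * v k - \<bar>S k i\<bar> * v i) + \<bar>S k i\<bar> / (1 - s) * ((r - s) * v i)"
  proof (intro add_mono mult_left_mono)
    show "(\<Sum>j\<in>I - {i}. \<bar>S k j\<bar> * v j) \<le> r * v k - \<bar>S k i\<bar> * v i"
      using S[OF k] split[of k] by linarith
    show "(\<Sum>j\<in>I - {i}. \<bar>S i j\<bar> * v j) \<le> (r - s) * v i"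
      using S[OF i] split[of i] unfolding s_def by (simp add: algebra_simps)
  qed (use s1 in auto)
  \<comment> \<open>Substituting row \<open>i\<close> costs no more than the term
    \<open>\<bar>S k i\<bar> * v i\<close> that row \<open>k\<close> saves by losing column
    \<open>i\<close>.\<close>
  also have "\<bar>S k i\<bar> / (1 - s) * ((r - s) * v i) \<le> \<bar>S k i\<bar> * v i"
  proof -
    have "(r - s) / (1 - s) \<le> 1" using s1 r by simp
    then have "(\<bar>S k i\<bar> * v i) * ((r - s) / (1 - s)) \<le> (\<bar>S k i\<bar> * v i) * 1"
      using v[OF i] by (intro mult_left_mono) auto
    then show ?thesis by (simp add: mult_ac)
  qed
  finally show ?thesis by simp
qed

text \<open>The dominant index keeps its sign from the first pass on; after its elimination the remaining
  indices form a system of the same kind, so each pass settles at least one more index.\<close>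

lemma full_flip_settles:
  fixes S :: "'a \<Rightarrow> 'a \<Rightarrow> real" and c v :: "'a \<Rightarrow> real" and x z :: "nat \<Rightarrow> 'a \<Rightarrow> real"
  assumes "finite I" and "0 \<le> r" "r < 1 / 2"
    and "\<And>i. i \<in> I \<Longrightarrow> v i > 0"
    and "\<And>i. i \<in> I \<Longrightarrow> (\<Sum>j\<in>I. \<bar>S i j\<bar> * v j) \<le> r * v i"
    and "\<And>t i. i \<in> I \<Longrightarrow> x t i = c i + (\<Sum>j\<in>I. S i j * (z t j * x t j))"
    and "\<And>t i. i \<in> I \<Longrightarrow> \<bar>z t i\<bar> = 1"
    and "\<And>t i. i \<in> I \<Longrightarrow> z (Suc t) i = (if z t i * x t i < 0 then - z t i else z t i)"
    and "k \<in> I" and "card I \<le> t"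
  shows "0 \<le> z t k * x t k"
  using assms
proof (induction "card I" arbitrary: I S c x z t k)
  case 0
  then show ?case by auto
next
  case (Suc p)
  note fin = Suc.prems(1) and r = Suc.prems(2,3) and v = Suc.prems(4) and S = Suc.prems(5)
    and x = Suc.prems(6) and z = Suc.prems(7) and step = Suc.prems(8)
  define m where "m = Max ((\<lambda>i. \<bar>c i\<bar> / v i) ` I)"
  have "m \<in> (\<lambda>i. \<bar>c i\<bar> / v i) ` I"
    unfolding m_def using fin \<open>k \<in> I\<close> by (intro Max_in) auto
  then obtain i where i: "i \<in> I" and m: "m = \<bar>c i\<bar> / v i" by auto
  have dom: "\<bar>c j\<bar> / v j \<le> \<bar>c i\<bar> / v i" if "j \<in> I" for j
    using fin that unfolding m[symmetric] m_def by (intro Max_ge) auto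
  have sgn_x: "sgn (x t i) = sgn (c i)" for t
    by (rule sign_of_dominant_entry[OF fin r v S x z i dom])
  \<comment> \<open>After a pass, \<open>z (Suc t) i\<close> agrees with the sign of
    \<open>x t i\<close>, and by \<open>sgn_x\<close> this is also the sign of
    \<open>x (Suc t) i\<close>. If that sign is 0, the product is 0.\<close>
  have stay: "0 \<le> z (Suc t) i * x (Suc t) i" for t
  proof -
    have "\<bar>z t i\<bar> = 1" using z[OF i] .
    then show ?thesis
      using sgn_x[of t] sgn_x[of "Suc t"] step[OF i, of t]
      by (auto simp: sgn_real_def mult_less_0_iff zero_le_mult_iff split: if_splits)
  qed
  \<comment> \<open>One pass is spent on \<open>i\<close>; at least \<open>p\<close> passes remain
    for the \<open>p\<close> other indices.\<close>
  obtain t' where t': "t = Suc t'" "p \<le> t'" using Suc.hyps(2) Suc.prems(10) by (cases t) auto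
  show ?case
  proof (cases "k = i")
    case True
    then show ?thesis using stay t' by simp
  next
    case False
    \<comment> \<open>The initial \<open>z 0 i\<close> may be wrong, so the sign is read off after
      the first pass. From then on \<open>stay\<close> excludes any flip at
      \<open>i\<close>.\<close>
    define \<sigma> where "\<sigma> = z (Suc 0) i"
    have \<sigma>: "\<bar>\<sigma>\<bar> = 1" unfolding \<sigma>_def by (rule z[OF i])
    have z_const: "z (Suc t) i = \<sigma>" for t
    proof (induction t)
      case (Suc t)
      have "z (Suc (Suc t)) i = z (Suc t) i" using step[OF i, of "Suc t"] stay[of t] by auto
      then show ?case using Suc by (rule trans)
    qed (simp add: \<sigma>_def)
    define D where "D = 1 - S i i * \<sigma>"
    have "\<bar>S i i\<bar> * v i \<le> r * v i"
    proof -
      have "\<bar>S i i\<bar> * v i \<le> (\<Sum>j\<in>I. \<bar>S i j\<bar> * v j)"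
        using v by (intro member_le_sum[OF i _ fin]) (auto simp: less_imp_le)
      then show ?thesis using S[OF i] by linarith
    qed
    then have "\<bar>S i i\<bar> < 1" using v[OF i] r by simp
    moreover have "\<bar>S i i * \<sigma>\<bar> = \<bar>S i i\<bar>" using \<sigma> by (simp add: abs_mult)
    ultimately have D: "D \<noteq> 0" unfolding D_def by auto
    \<comment> \<open>With \<open>z (Suc t) i\<close> fixed to \<open>\<sigma>\<close>, equation
      \<open>i\<close> is linear in its own unknown with coefficient \<open>D\<close> and can be
      solved for \<open>x (Suc t) i\<close>.\<close>
    have xi: "x (Suc t) i = (c i + (\<Sum>j\<in>I - {i}. S i j * (z (Suc t) j * x (Suc t) j))) / D" for t
    proof -
      have "x (Suc t) i = c i + (S i i * (\<sigma> * x (Suc t) i)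
          + (\<Sum>j\<in>I - {i}. S i j * (z (Suc t) j * x (Suc t) j)))"
        using x[OF i, of "Suc t"] z_const[of t] by (simp add: sum.remove[OF fin i])
      then have "D * x (Suc t) i = c i + (\<Sum>j\<in>I - {i}. S i j * (z (Suc t) j * x (Suc t) j))"
        unfolding D_def by (simp add: algebra_simps)
      then show ?thesis using nonzero_eq_divide_eq[OF D] by (simp add: mult.commute)
    qed
    \<comment> \<open>The induction hypothesis is applied to the sequences shifted by one pass, and
      to the matrix and vector obtained by substituting \<open>xi\<close> into the other rows, a
      Schur complement.\<close>
    have "0 \<le> z (Suc t') k * x (Suc t') k"
    proof (rule Suc.hyps(1)[of "I - {i}" "\<lambda>k j. S k j + S k i * \<sigma> * S i j / D"
          "\<lambda>t. x (Suc t)" "\<lambda>k. c k + S k i * \<sigma> * c i / D" "\<lambda>t. z (Suc t)" k t'])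
      show "p = card (I - {i})" using Suc.hyps(2) i fin by simp
      then show "card (I - {i}) \<le> t'" using t' by simp
      show "(\<Sum>j\<in>I - {i}. \<bar>S l j + S l i * \<sigma> * S i j / D\<bar> * v j) \<le> r * v l" if "l \<in> I - {i}" for l
        unfolding D_def by (rule weighted_norm_eliminate[OF fin _ _ v S i _ \<sigma>]) (use r that in auto)
      show "x (Suc t) l = c l + S l i * \<sigma> * c i / D
          + (\<Sum>j\<in>I - {i}. (S l j + S l i * \<sigma> * S i j / D) * (z (Suc t) j * x (Suc t) j))"
        if "l \<in> I - {i}" for t l
      proof -
        let ?T = "\<lambda>l. \<Sum>j\<in>I - {i}. S l j * (z (Suc t) j * x (Suc t) j)"
        have distrib: "a * (\<sigma> * ((p + q) / D)) = a * \<sigma> * p / D + a * \<sigma> / D * q" for a p q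
          by (simp add: add_divide_distrib ring_distribs)
        have 1: "x (Suc t) l = c l + (S l i * (\<sigma> * x (Suc t) i) + ?T l)"
          using x[of l "Suc t"] that z_const[of t] by (simp add: sum.remove[OF fin i])
        have 2: "S l i * (\<sigma> * x (Suc t) i) = S l i * \<sigma> * c i / D + S l i * \<sigma> / D * ?T i"
          by (subst xi) (rule distrib)
        have 3: "(\<Sum>j\<in>I - {i}. (S l j + S l i * \<sigma> * S i j / D) * (z (Suc t) j * x (Suc t) j))
            = ?T l + S l i * \<sigma> / D * ?T i"
          by (simp add: sum_distrib_left sum.distrib distrib_right mult.assoc)
        show ?thesis unfolding 3 using 1 2 by linarith
      qed
      show "z (Suc (Suc t)) l = (if z (Suc t) l * x (Suc t) l < 0 then - z (Suc t) l else z (Suc t) l)"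
        if "l \<in> I - {i}" for t l
        using step that by blast
    qed (use fin r v z False \<open>k \<in> I\<close> in auto)
    then show ?thesis using t' by simp
  qed
qed

section \<open>Positive weights from the spectral radius\<close>

text \<open>An eigenvector of the scaled matrix for \<open>e\<close> is an eigenvector of
  \<open>M\<close> for \<open>t * e\<close>, so \<open>t * norm e\<close> is at most the spectral
  radius of \<open>M\<close>, which is below \<open>t\<close>.\<close>

lemma spectral_radius_smult_less_1:
  assumes M: "M \<in> carrier_mat n n" and n: "n > 0" and t: "t > 0" and sr: "spectral_radius M < t"
  shows "spectral_radius (complex_of_real (1 / t) \<cdot>\<^sub>m M) < 1"
proof -
  let ?N = "complex_of_real (1 / t) \<cdot>\<^sub>m M"
  have N: "?N \<in> carrier_mat n n" using M by simp
  obtain e where e: "eigenvalue ?N e" and eq: "spectral_radius ?N = norm e"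
    using spectral_radius_mem_max(1)[OF N n] by (auto simp: spectrum_def)
  obtain w where w: "w \<in> carrier_vec n" "w \<noteq> 0\<^sub>v n" and ev: "?N *\<^sub>v w = e \<cdot>\<^sub>v w"
    using e M unfolding eigenvalue_def eigenvector_def by auto
  have Nw: "?N *\<^sub>v w = complex_of_real (1 / t) \<cdot>\<^sub>v (M *\<^sub>v w)"
    using M w by (intro eq_vecI) auto
  have "M *\<^sub>v w = (complex_of_real t * e) \<cdot>\<^sub>v w"
  proof -
    have "M *\<^sub>v w = complex_of_real t \<cdot>\<^sub>v (complex_of_real (1 / t) \<cdot>\<^sub>v (M *\<^sub>v w))"
      using t by (simp add: smult_smult_assoc flip: of_real_mult)
    also have "\<dots> = (complex_of_real t * e) \<cdot>\<^sub>v w"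
      by (simp only: Nw[symmetric] ev smult_smult_assoc)
    finally show ?thesis .
  qed
  then have "eigenvalue M (complex_of_real t * e)"
    using w M unfolding eigenvalue_def eigenvector_def by auto
  then have "norm (complex_of_real t * e) \<le> spectral_radius M"
    by (intro spectral_radius_mem_max(2)[OF M n]) (auto simp: spectrum_def)
  then have "t * norm e < t * 1"
    using sr unfolding norm_mult norm_of_real abs_of_pos[OF t] by linarith
  then show ?thesis unfolding eq by (simp only: mult_less_cancel_left_pos[OF t])
qed

text \<open>A truncated Neumann series applied to the all-ones vector replaces the Perron vector, which
  need not be positive for a reducible matrix.\<close>

lemma spectral_radius_weights:
  fixes M :: "real mat"
  assumes M: "M \<in> carrier_mat n n" and n: "n > 0"
    and nonneg: "\<And>i j. i < n \<Longrightarrow> j < n \<Longrightarrow> M $$ (i, j) \<ge> 0"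
    and sr: "real_spectral_radius M < r"
  obtains v where "\<And>i. i < n \<Longrightarrow> v i > 0"
    and "\<And>i. i < n \<Longrightarrow> (\<Sum>j<n. M $$ (i, j) * v j) \<le> r * v i"
proof -
  have cM: "map_mat complex_of_real M \<in> carrier_mat n n" using M by simp
  have "0 \<le> real_spectral_radius M"
    using spectral_radius_mem_max(1)[OF cM n] unfolding real_spectral_radius_def by auto
  \<comment> \<open>The gap up to \<open>r\<close> is split in two: dividing by \<open>t\<close>
    makes the powers of the matrix bounded, and the remaining factor \<open>t / r < 1\<close> makes
    the series terms decay.\<close>
  moreover obtain t where t: "real_spectral_radius M < t" "t < r" using sr dense by blast
  ultimately have t0: "t > 0" and r0: "r > 0" by auto
  define N where "N = (1 / t) \<cdot>\<^sub>m M"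
  have N: "N \<in> carrier_mat n n" unfolding N_def using M by simp
  have cN: "map_mat complex_of_real N = complex_of_real (1 / t) \<cdot>\<^sub>m map_mat complex_of_real M"
    unfolding N_def using M by (intro eq_matI) auto
  have "spectral_radius (map_mat complex_of_real N) < 1"
    unfolding cN using t(1)[unfolded real_spectral_radius_def]
    by (rule spectral_radius_smult_less_1[OF cM n t0])
  then obtain c where c: "\<And>k. norm_bound (map_mat complex_of_real N ^\<^sub>m k) c"
    using spectral_radius_jnf_norm_bound_less_1_upper_triangular[of "map_mat complex_of_real N" n] N
    by auto
  have Nk: "N ^\<^sub>m k \<in> carrier_mat n n" for k using N by simp
  have bound: "\<bar>(N ^\<^sub>m k) $$ (i, j)\<bar> \<le> c" if "i < n" "j < n" for i j k
    using c[of k] that carrier_matD[OF Nk[of k]]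
    unfolding of_real_hom.mat_hom_pow[OF N, symmetric] norm_bound_def
    by (auto simp del: pow_mat_dim)
  \<comment> \<open>Matrix powers unfold with the new factor on the right; the recursion
    \<open>uS\<close> for row sums needs it on the left.\<close>
  have comm: "N ^\<^sub>m Suc k = N * N ^\<^sub>m k" for k
  proof (induction k)
    case (Suc k)
    have "N ^\<^sub>m Suc (Suc k) = (N * N ^\<^sub>m k) * N" using Suc by simp
    also have "\<dots> = N * (N ^\<^sub>m k * N)" by (rule assoc_mult_mat[OF N Nk N])
    finally show ?case by simp
  qed (use N in simp)
  \<comment> \<open>\<open>u k\<close> is \<open>N ^\<^sub>m k\<close> applied to the all-ones
    vector.\<close>
  define u where "u k i = (\<Sum>j<n. (N ^\<^sub>m k) $$ (i, j))" for k i
  have u0: "u 0 i = 1" if "i < n" for i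
    using that N unfolding u_def by (simp add: sum.delta)
  have uS: "u (Suc k) i = (\<Sum>l<n. N $$ (i, l) * u k l)" if "i < n" for k i
  proof -
    have "u (Suc k) i = (\<Sum>j<n. \<Sum>l<n. N $$ (i, l) * (N ^\<^sub>m k) $$ (l, j))"
      unfolding u_def comm using that N Nk[of k]
      by (intro sum.cong) (auto simp: scalar_prod_def atLeast0LessThan)
    also have "\<dots> = (\<Sum>l<n. \<Sum>j<n. N $$ (i, l) * (N ^\<^sub>m k) $$ (l, j))" by (rule sum.swap)
    finally show ?thesis unfolding u_def by (simp add: sum_distrib_left)
  qed
  have Nnn: "N $$ (i, j) \<ge> 0" if "i < n" "j < n" for i j
    using nonneg[OF that] that M t0 unfolding N_def by simp
  have unn: "u k i \<ge> 0" if "i < n" for k i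
    using that
  proof (induction k arbitrary: i)
    case 0
    then show ?case using u0 by simp
  next
    case (Suc k)
    then show ?case unfolding uS[OF Suc.prems] by (intro sum_nonneg mult_nonneg_nonneg Nnn) auto
  qed
  have ub: "u k i \<le> real n * c" if "i < n" for k i
  proof -
    have "u k i \<le> (\<Sum>j<n. c)" unfolding u_def
      using bound[OF that] by (intro sum_mono) (auto dest: abs_le_D1)
    then show ?thesis by simp
  qed
  define q where "q = t / r"
  have q: "0 < q" "q < 1" unfolding q_def using t t0 r0 by auto
  have "(\<lambda>K. q ^ K * (real n * c)) \<longlonglongrightarrow> 0 * (real n * c)"
    using q by (intro tendsto_mult LIMSEQ_realpow_zero tendsto_const) auto
  then have "eventually (\<lambda>K. q ^ K * (real n * c) < 1) sequentially"
    by (intro order_tendstoD(2)) auto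
  then obtain K0 where K0: "\<And>K. K \<ge> K0 \<Longrightarrow> q ^ K * (real n * c) < 1"
    unfolding eventually_sequentially by blast
  \<comment> \<open>The successor guarantees \<open>K > 0\<close>, so that the series below contains
    the term for \<open>k = 0\<close>, which equals 1 and makes \<open>v\<close> positive.\<close>
  define K where "K = Suc K0"
  have K: "q ^ K * (real n * c) < 1" unfolding K_def by (rule K0) simp
  \<comment> \<open>Since \<open>q * N = M / r\<close> entrywise, this is the Neumann series of
    \<open>M / r\<close>, cut off after \<open>K\<close> terms and applied to the all-ones
    vector.\<close>
  define v where "v i = (\<Sum>k<K. q ^ k * u k i)" for i
  show ?thesis
  proof (rule that[of v])
    fix i assume i: "i < n"
    have "q ^ 0 * u 0 i \<le> v i" unfolding v_def
      using unn[OF i] q by (intro member_le_sum) (auto simp: K_def)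
    then show "v i > 0" using u0[OF i] by simp
    have "M $$ (i, j) = t * N $$ (i, j)" if "j < n" for j
      using i that M t0 unfolding N_def by simp
    then have "(\<Sum>j<n. M $$ (i, j) * v j) = (\<Sum>j<n. \<Sum>k<K. t * q ^ k * (N $$ (i, j) * u k j))"
      unfolding v_def by (intro sum.cong) (auto simp: sum_distrib_left mult_ac)
    also have "\<dots> = (\<Sum>k<K. \<Sum>j<n. t * q ^ k * (N $$ (i, j) * u k j))" by (rule sum.swap)
    also have "\<dots> = (\<Sum>k<K. r * (q ^ Suc k * u (Suc k) i))"
      unfolding uS[OF i] using r0 by (intro sum.cong) (auto simp: sum_distrib_left q_def)
    also have "\<dots> = r * (\<Sum>k<K. q ^ Suc k * u (Suc k) i)" by (simp add: sum_distrib_left)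
    \<comment> \<open>Multiplication by \<open>M / r\<close> shifts the series by one: it loses the
      first term 1 and gains \<open>q ^ K * u K i\<close>, which is below 1 by the choice of
      \<open>K\<close>.\<close>
    also have "(\<Sum>k<K. q ^ Suc k * u (Suc k) i) = v i + q ^ K * u K i - 1"
      using sum.lessThan_Suc_shift[of "\<lambda>k. q ^ k * u k i" K] u0[OF i] unfolding v_def by simp
    also have "r * (v i + q ^ K * u K i - 1) \<le> r * v i"
    proof -
      have "q ^ K * u K i \<le> q ^ K * (real n * c)" using q ub[OF i] by (intro mult_left_mono) auto
      then show ?thesis using K r0 by (intro mult_left_mono) auto
    qed
    finally show "(\<Sum>j<n. M $$ (i, j) * v j) \<le> r * v i" .
  qed
qed

section \<open>Inverses and nonsingularity\<close>

text \<open>An invertible matrix is a unit of the matrix ring, and on units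
  \<open>mat_inverse\<close> does not return \<open>None\<close>; hence \<open>inv_mat\<close> is
  the true inverse.\<close>

lemma inv_mat:
  assumes X: "X \<in> carrier_mat n n" and inv: "invertible_mat X"
  shows "inv_mat X \<in> carrier_mat n n" "X * inv_mat X = 1\<^sub>m n" "inv_mat X * X = 1\<^sub>m n"
proof -
  obtain Y where Y: "X * Y = 1\<^sub>m n" "Y * X = 1\<^sub>m (dim_row Y)"
    using inv X unfolding invertible_mat_def inverts_mat_def by auto
  \<comment> \<open>\<open>invertible_mat\<close> leaves the dimensions of \<open>Y\<close> open;
    the two product equations force them.\<close>
  then have "dim_col Y = n" "dim_row Y = n"
    using X by (metis index_mult_mat(3) index_one_mat(3), metis X carrier_matD(2) index_mult_mat(3) index_one_mat(3))
  then have "X \<in> Units (ring_mat TYPE(real) n ())"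
    unfolding Units_def ring_mat_simps using X Y by auto
  then obtain B where "mat_inverse X = Some B"
    using mat_inverse(1)[OF X, where b = "()"] by (cases "mat_inverse X") auto
  then show "inv_mat X \<in> carrier_mat n n" "X * inv_mat X = 1\<^sub>m n" "inv_mat X * X = 1\<^sub>m n"
    using mat_inverse(2)[OF X] by (auto simp: inv_mat_def)
qed

lemma invertible_mat_if_kernel_trivial:
  fixes X :: "real mat"
  assumes X: "X \<in> carrier_mat n n"
    and ker: "\<And>y. y \<in> carrier_vec n \<Longrightarrow> X *\<^sub>v y = 0\<^sub>v n \<Longrightarrow> y = 0\<^sub>v n"
  shows "invertible_mat X"
proof -
  have "det X \<noteq> 0" using det_0_iff_vec_prod_zero_field[OF X] ker by blast
  then have "X \<in> Units (ring_mat TYPE(real) n ())" by (rule det_non_zero_imp_unit[OF X])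
  then obtain Y where "Y \<in> carrier_mat n n" "X * Y = 1\<^sub>m n" "Y * X = 1\<^sub>m n"
    unfolding Units_def ring_mat_simps by auto
  then show ?thesis using X unfolding invertible_mat_def inverts_mat_def by auto
qed

section \<open>Runs of the algorithm and the equations satisfied by its iterates\<close>

text \<open>The settling argument concerns the infinite sequence of iterates of \<open>f\<close>,
  whereas a run ends as soon as the mismatch set is empty. The run follows the sequence up to the
  first such index, which is at most \<open>K\<close>.\<close>

lemma gnm_run_of_iterates:
  fixes A b
  defines "f \<equiv> \<lambda>z. flip (mismatch z (gnm_point A b z)) z"
  assumes "\<And>t. invertible_mat (A - Diag ((f ^^ t) z))"
    and "mismatch ((f ^^ K) z) (gnm_point A b ((f ^^ K) z)) = {}"
  shows "\<exists>k\<le>K. \<exists>x. gnm_run A b z k x"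
  using assms(2,3)
proof (induction K arbitrary: z)
  case 0
  then show ?case using gnm_run.stop[of A z, OF _ refl] 0(1)[of 0] by auto
next
  case (Suc K)
  have inv: "invertible_mat (A - Diag z)" using Suc.prems(1)[of 0] by simp
  show ?case
  proof (cases "mismatch z (gnm_point A b z) = {}")
    case True
    then show ?thesis using gnm_run.stop[OF inv refl] by auto
  next
    case False
    have "invertible_mat (A - Diag ((f ^^ t) (f z)))" for t
      using Suc.prems(1)[of "Suc t"] by (simp add: funpow_swap1)
    moreover have "mismatch ((f ^^ K) (f z)) (gnm_point A b ((f ^^ K) (f z))) = {}"
      using Suc.prems(2) by (simp add: funpow_swap1)
    ultimately obtain k x where "k \<le> K" "gnm_run A b (f z) k x" using Suc.IH by blast
    then show ?thesis using gnm_run.step[OF inv refl False] unfolding f_def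
      by (meson Suc_le_mono)
  qed
qed

lemma sign_vecsD:
  assumes "z \<in> sign_vecs n"
  shows "z \<in> carrier_vec n" "i < n \<Longrightarrow> \<bar>z $ i\<bar> = 1"
  using assms unfolding sign_vecs_def by auto

lemma flip_sign_vecs: "z \<in> sign_vecs n \<Longrightarrow> flip V z \<in> sign_vecs n"
  unfolding sign_vecs_def flip_def by force

lemma Diag_carrier [simp]: "z \<in> carrier_vec n \<Longrightarrow> Diag z \<in> carrier_mat n n"
  unfolding Diag_def by auto

lemma Diag_mult_vec:
  assumes "z \<in> carrier_vec n" "x \<in> carrier_vec n" "i < n"
  shows "(Diag z *\<^sub>v x) $ i = z $ i * x $ i"
proof -
  have "(Diag z *\<^sub>v x) $ i = (\<Sum>j = 0..<n. (if i = j then z $ j else 0) * x $ j)"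
    using assms unfolding Diag_def mat_diag_def by (simp add: scalar_prod_def)
  also have "\<dots> = (\<Sum>j = 0..<n. if i = j then z $ j * x $ j else 0)" by (intro sum.cong) auto
  finally show ?thesis using assms(3) by simp
qed

lemma gnm_point_solves:
  assumes A: "A \<in> carrier_mat n n" and b: "b \<in> carrier_vec n" and z: "z \<in> carrier_vec n"
    and inv: "invertible_mat (A - Diag z)"
  shows "gnm_point A b z \<in> carrier_vec n"
    and "A *\<^sub>v gnm_point A b z - Diag z *\<^sub>v gnm_point A b z = b"
proof -
  have X: "A - Diag z \<in> carrier_mat n n" using A z by (intro minus_carrier_mat) simp
  note I = inv_mat[OF X inv]
  show x: "gnm_point A b z \<in> carrier_vec n" unfolding gnm_point_def using I(1) b by simp
  have "(A - Diag z) *\<^sub>v gnm_point A b z = b"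
    unfolding gnm_point_def using assoc_mult_mat_vec[OF X I(1) b] I(2) b by simp
  then show "A *\<^sub>v gnm_point A b z - Diag z *\<^sub>v gnm_point A b z = b"
    using minus_mult_distrib_mat_vec[OF A _ x, of "Diag z"] z by simp
qed

text \<open>At the stop every \<open>z $ i * x $ i\<close> is nonnegative and \<open>z $ i\<close>
  has modulus 1, so the product equals \<open>\<bar>x $ i\<bar>\<close>. The linear system for
  \<open>z\<close> then coincides with the absolute value equation.\<close>

lemma gnm_run_returns_solution:
  assumes "gnm_run A b z k x" and A: "A \<in> carrier_mat n n" and b: "b \<in> carrier_vec n"
    and "z \<in> sign_vecs n"
  shows "is_ave_solution A b x"
  using assms(1,4)
proof (induction rule: gnm_run.induct)
  case (stop z x)
  note z = sign_vecsD[OF stop(4)]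
  note sol = gnm_point_solves[OF A b z(1) stop(1), folded stop(2)]
  have "Diag z *\<^sub>v x = abs_vec x"
  proof (rule eq_vecI)
    fix i assume "i < dim_vec (abs_vec x)"
    then have i: "i < n" using sol(1) by (simp add: abs_vec_def)
    then have "0 \<le> z $ i * x $ i" using stop(3) z(1) unfolding mismatch_def by force
    then have "z $ i * x $ i = \<bar>x $ i\<bar>" using z(2)[OF i] by (metis abs_mult abs_of_nonneg mult_1)
    then show "(Diag z *\<^sub>v x) $ i = abs_vec x $ i"
      using Diag_mult_vec[OF z(1) sol(1) i] i sol(1) by (simp add: abs_vec_def)
  qed (use z(1) sol(1) in \<open>simp add: abs_vec_def Diag_def mat_diag_def\<close>)
  then show ?case using sol A unfolding is_ave_solution_def by simp
next
  case (step z x k y)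
  then show ?case using flip_sign_vecs by blast
qed

text \<open>Multiplication by \<open>B\<close> gives the fixed-point form of the equation. It serves
  with \<open>y\<close> equal to \<open>Diag z *\<^sub>v x\<close> for iterates and kernel vectors,
  and with \<open>y\<close> equal to \<open>abs_vec x\<close> for solutions.\<close>

lemma left_inverse_mult_vec:
  fixes A :: "real mat"
  assumes A: "A \<in> carrier_mat n n" and B: "B \<in> carrier_mat n n" and BA: "B * A = 1\<^sub>m n"
    and x: "x \<in> carrier_vec n" and y: "y \<in> carrier_vec n" and b: "b \<in> carrier_vec n"
    and eq: "A *\<^sub>v x - y = b" and i: "i < n"
  shows "x $ i = (B *\<^sub>v b) $ i + (\<Sum>j<n. B $$ (i, j) * y $ j)"
proof -
  have "x = B *\<^sub>v (A *\<^sub>v x)" using assoc_mult_mat_vec[OF B A x] BA x by simp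
  also have "A *\<^sub>v x = b + y" using eq A x y b by (intro eq_vecI) auto
  also have "B *\<^sub>v (b + y) = B *\<^sub>v b + B *\<^sub>v y" by (rule mult_add_distrib_mat_vec[OF B b y])
  finally have "x $ i = (B *\<^sub>v b + B *\<^sub>v y) $ i" by simp
  then show ?thesis using B b y i by (simp add: scalar_prod_def atLeast0LessThan)
qed

section \<open>Nonsingularity, uniqueness and termination under a weighted contraction bound\<close>

text \<open>The spectral radius condition enters only through the weights: \<open>Bv\<close> bounds
  by \<open>r\<close> the operator norm of \<open>B\<close> for the maximum norm weighted by
  \<open>v\<close>.\<close>

locale contractive_ave =
  fixes A B :: "real mat" and n :: nat and v :: "nat \<Rightarrow> real" and r :: real
  assumes A: "A \<in> carrier_mat n n" and B: "B \<in> carrier_mat n n" and BA: "B * A = 1\<^sub>m n"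
    and r: "0 \<le> r" "r < 1 / 2"
    and v: "\<And>i. i < n \<Longrightarrow> v i > 0"
    and Bv: "\<And>i. i < n \<Longrightarrow> (\<Sum>j<n. \<bar>B $$ (i, j)\<bar> * v j) \<le> r * v i"
begin

lemma zero_if_dominated:
  assumes "\<And>i. i < n \<Longrightarrow> \<bar>y i\<bar> \<le> (\<Sum>j<n. \<bar>B $$ (i, j)\<bar> * \<bar>y j\<bar>)" and "i < n"
  shows "y i = 0"
  using weighted_bound[where I = "{..<n}" and S = "\<lambda>i j. B $$ (i, j)" and v = v and y = y
      and a = 0 and r = r and i = i] assms v Bv r by simp

text \<open>A kernel vector satisfies \<open>y = B Z y\<close>, hence
  \<open>\<bar>y\<bar> \<le> \<bar>B\<bar> \<bar>y\<bar>\<close> entrywise, and a contraction admits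
  only \<open>y = 0\<close>.\<close>

lemma invertible_minus_Diag:
  assumes z: "z \<in> sign_vecs n"
  shows "invertible_mat (A - Diag z)"
proof (rule invertible_mat_if_kernel_trivial)
  note z = sign_vecsD[OF z]
  show "A - Diag z \<in> carrier_mat n n" using A z by (intro minus_carrier_mat) simp
  fix y assume y: "y \<in> carrier_vec n" and "(A - Diag z) *\<^sub>v y = 0\<^sub>v n"
  then have eq: "A *\<^sub>v y - Diag z *\<^sub>v y = 0\<^sub>v n"
    using minus_mult_distrib_mat_vec[OF A _ y, of "Diag z"] z by simp
  have Dy: "Diag z *\<^sub>v y \<in> carrier_vec n"
    using z(1) y by (intro mult_mat_vec_carrier[OF Diag_carrier])
  have dom: "\<bar>y $ i\<bar> \<le> (\<Sum>j<n. \<bar>B $$ (i, j)\<bar> * \<bar>y $ j\<bar>)" if "i < n" for i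
  proof -
    have "y $ i = (\<Sum>j<n. B $$ (i, j) * (z $ j * y $ j))"
      using left_inverse_mult_vec[OF A B BA y Dy _ eq that] that B z(1) y by (simp add: Diag_mult_vec)
    then show ?thesis
      by (auto simp: abs_mult z(2) intro!: order_trans[OF sum_abs] sum_mono)
  qed
  have "y $ i = 0" if "i < n" for i by (rule zero_if_dominated[OF dom that])
  then show "y = 0\<^sub>v n" using y by (intro eq_vecI) auto
qed

text \<open>The absolute value is 1-Lipschitz, so the difference of two solutions is dominated by
  \<open>\<bar>B\<bar>\<close> applied to its own modulus and vanishes.\<close>

lemma ave_solution_unique:
  assumes b: "b \<in> carrier_vec n" and "is_ave_solution A b x" "is_ave_solution A b y"
  shows "x = y"
proof -
  have x: "x \<in> carrier_vec n" "A *\<^sub>v x - abs_vec x = b"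
    and y: "y \<in> carrier_vec n" "A *\<^sub>v y - abs_vec y = b"
    using assms A unfolding is_ave_solution_def by auto
  have c: "abs_vec w \<in> carrier_vec n" if "w \<in> carrier_vec n" for w
    using that unfolding abs_vec_def by simp
  have dom: "\<bar>x $ i - y $ i\<bar> \<le> (\<Sum>j<n. \<bar>B $$ (i, j)\<bar> * \<bar>x $ j - y $ j\<bar>)" if "i < n" for i
  proof -
    have "x $ i - y $ i = (\<Sum>j<n. B $$ (i, j) * (\<bar>x $ j\<bar> - \<bar>y $ j\<bar>))"
      unfolding left_inverse_mult_vec[OF A B BA x(1) c[OF x(1)] b x(2) that]
        left_inverse_mult_vec[OF A B BA y(1) c[OF y(1)] b y(2) that]
      using x(1) y(1) by (simp add: abs_vec_def sum_subtractf right_diff_distrib)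
    then show ?thesis
      by (auto simp: abs_mult intro!: order_trans[OF sum_abs] sum_mono mult_left_mono)
  qed
  have "x $ i - y $ i = 0" if "i < n" for i
    by (rule zero_if_dominated[where y = "\<lambda>i. x $ i - y $ i", OF dom that])
  then show ?thesis using x(1) y(1) by (intro eq_vecI) auto
qed

text \<open>All \<open>n\<close> indices have settled after \<open>n\<close> passes of the sequence
  \<open>w\<close>, so its mismatch set at \<open>n\<close> is empty and the loop has ended by
  then.\<close>

lemma gnm_run_exists:
  assumes b: "b \<in> carrier_vec n" and z: "z \<in> sign_vecs n"
  shows "\<exists>k\<le>n. \<exists>x. gnm_run A b z k x"
proof -
  define f where "f = (\<lambda>z. flip (mismatch z (gnm_point A b z)) z)"
  define w where "w t = (f ^^ t) z" for t
  have w: "w t \<in> sign_vecs n" for t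
    unfolding w_def by (induction t) (auto simp: z f_def flip_sign_vecs)
  note wc = sign_vecsD[OF w]
  have inv: "invertible_mat (A - Diag (w t))" for t using invertible_minus_Diag[OF w] .
  define x where "x t = gnm_point A b (w t)" for t
  note sol = gnm_point_solves[OF A b wc(1) inv, folded x_def]
  have step: "w (Suc t) $ i = (if w t $ i * x t $ i < 0 then - w t $ i else w t $ i)"
    if "i < n" for t i
    using that wc(1)[of t] unfolding w_def x_def by (simp add: f_def flip_def mismatch_def)
  have fp: "x t $ i = (B *\<^sub>v b) $ i + (\<Sum>j<n. B $$ (i, j) * (w t $ j * x t $ j))" if "i < n" for t i
  proof -
    have "Diag (w t) *\<^sub>v x t \<in> carrier_vec n"
      using wc(1) sol(1) by (intro mult_mat_vec_carrier[OF Diag_carrier])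
    from left_inverse_mult_vec[OF A B BA sol(1)[of t] this b sol(2) that]
    show ?thesis by (simp add: Diag_mult_vec[OF wc(1) sol(1)])
  qed
  have "0 \<le> w n $ i * x n $ i" if "i < n" for i
  proof (rule full_flip_settles[where I = "{..<n}" and S = "\<lambda>i j. B $$ (i, j)" and v = v and r = r
        and x = "\<lambda>t i. x t $ i" and z = "\<lambda>t i. w t $ i" and c = "\<lambda>i. (B *\<^sub>v b) $ i"])
    show "x t $ l = (B *\<^sub>v b) $ l + (\<Sum>j<n. B $$ (l, j) * (w t $ j * x t $ j))"
      if "l \<in> {..<n}" for t l
      using fp that by blast
    show "w (Suc t) $ l = (if w t $ l * x t $ l < 0 then - w t $ l else w t $ l)"
      if "l \<in> {..<n}" for t l
      using step that by blast
  qed (use that r v Bv wc(2) in auto)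
  then have "mismatch (w n) (x n) = {}" using wc(1)[of n] unfolding mismatch_def by force
  then show ?thesis
    using inv unfolding w_def x_def f_def by (intro gnm_run_of_iterates)
qed

end

section \<open>Data size and the iteration bound\<close>

lemma sign_vecs_nonempty: "vec n (\<lambda>_. 1) \<in> sign_vecs n"
  unfolding sign_vecs_def by auto

lemma data_size_ge:
  "dA \<le> data_size A' dA b' db"
  "i < dim_row A' \<Longrightarrow> j < dim_col A' \<Longrightarrow> \<bar>A' $$ (i, j)\<bar> \<le> data_size A' dA b' db"
proof -
  show "dA \<le> data_size A' dA b' db" unfolding data_size_def by simp
  assume ij: "i < dim_row A'" "j < dim_col A'"
  have "\<bar>A' $$ (i, j)\<bar> \<le> mat_max_norm A'"
    unfolding mat_max_norm_def
  proof (intro Max_ge imageI)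
    show "finite (abs ` elements_mat A')" unfolding elements_mat_def by simp
    show "A' $$ (i, j) \<in> elements_mat A'" using ij by (intro elements_matI[OF carrier_matI]) auto
  qed
  also have "\<dots> \<le> data_size A' dA b' db" unfolding data_size_def by simp
  finally show "\<bar>A' $$ (i, j)\<bar> \<le> data_size A' dA b' db" .
qed

theorem corollary4p5:
  fixes \<rho> :: real
  assumes "\<rho> < 1 / 2"
  shows "\<exists>C>0. \<forall>(n::nat) (A::real mat) (b::real vec) (A'::int mat) (b'::int vec) (dA::int) (db::int).
    n \<ge> 1 \<longrightarrow>
    A \<in> carrier_mat n n \<longrightarrow> elements_mat A \<subseteq> \<rat> \<longrightarrow> invertible_mat A \<longrightarrow>
    real_spectral_radius (abs_mat (inv_mat A)) \<le> \<rho> \<longrightarrow>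
    b \<in> carrier_vec n \<longrightarrow> set\<^sub>v b \<subseteq> \<rat> \<longrightarrow>
    A' \<in> carrier_mat n n \<longrightarrow> b' \<in> carrier_vec n \<longrightarrow> dA > 0 \<longrightarrow> db > 0 \<longrightarrow>
    A = (1 / of_int dA) \<cdot>\<^sub>m map_mat of_int A' \<longrightarrow>
    b = (1 / of_int db) \<cdot>\<^sub>v map_vec of_int b' \<longrightarrow>
    (\<exists>x. {y. is_ave_solution A b y} = {x} \<and>
      (\<forall>z\<in>sign_vecs n. \<exists>k. gnm_run A b z k x \<and>
        real k \<le> C * (real n)\<^sup>2 * ln (real n * of_int (data_size A' dA b' db))))"
proof (intro exI[of _ "1 / ln 2"] conjI allI impI)
  \<comment> \<open>From \<open>n * L \<ge> 2\<close> it follows that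
    \<open>ln (n * L) / ln 2 \<ge> 1\<close>, so this constant absorbs the bound \<open>n\<close> on
    the passes, for every \<open>\<rho>\<close> below one half.\<close>
  show "(0::real) < 1 / ln 2" by simp
  fix n :: nat and A :: "real mat" and b :: "real vec" and A' :: "int mat" and b' :: "int vec"
    and dA db :: int
  assume n: "n \<ge> 1" and A: "A \<in> carrier_mat n n" and inv: "invertible_mat A"
    and sr: "real_spectral_radius (abs_mat (inv_mat A)) \<le> \<rho>" and b: "b \<in> carrier_vec n"
    and A': "A' \<in> carrier_mat n n" and dA: "dA > 0"
    and AA': "A = (1 / of_int dA) \<cdot>\<^sub>m map_mat of_int A'"
  define B where "B = inv_mat A"
  note B_inv = inv_mat[OF A inv, folded B_def]
  \<comment> \<open>The midpoint between \<open>max \<rho> 0\<close> and one half lies strictly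
    above \<open>\<rho>\<close>, as the construction of weights requires, and is nonnegative even
    for negative \<open>\<rho>\<close>.\<close>
  define r where "r = (max \<rho> 0 + 1 / 2) / 2"
  have r: "\<rho> < r" "0 \<le> r" "r < 1 / 2" using assms unfolding r_def by auto
  have absB: "abs_mat B \<in> carrier_mat n n" using B_inv(1) unfolding abs_mat_def by simp
  obtain v where v: "\<And>i. i < n \<Longrightarrow> v i > 0"
    and Bv: "\<And>i. i < n \<Longrightarrow> (\<Sum>j<n. abs_mat B $$ (i, j) * v j) \<le> r * v i"
    by (rule spectral_radius_weights[OF absB, of r])
      (use n sr r B_inv(1) in \<open>auto simp: abs_mat_def B_def\<close>)
  interpret contractive_ave A B n v r
    by unfold_locales (use A B_inv r v Bv in \<open>auto simp: abs_mat_def\<close>)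
  define L where "L = data_size A' dA b' db"
  \<comment> \<open>For \<open>n = 1\<close> the condition \<open>\<rho> < 1 / 2\<close> itself rules out \<open>L = 1\<close>, where the logarithm would vanish.\<close>
  have size: "2 \<le> real n * of_int L"
  proof (cases "n = 1")
    case False
    have "1 \<le> L" using data_size_ge(1)[of dA A' b' db] dA unfolding L_def by linarith
    then have "2 * 1 \<le> real n * of_int L" using n False by (intro mult_mono) auto
    then show ?thesis by simp
  next
    case True
    \<comment> \<open>The only entry of \<open>A\<close> is the reciprocal of that of
      \<open>B\<close>, so its modulus is at least 2. Clearing the denominator
      \<open>dA \<ge> 1\<close> cannot decrease it.\<close>
    have "\<bar>B $$ (0, 0)\<bar> * v 0 \<le> r * v 0" using Bv[of 0] B_inv(1) True by (simp add: abs_mat_def)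
    then have B0: "\<bar>B $$ (0, 0)\<bar> < 1 / 2" using v[of 0] True r by simp
    have "(B * A) $$ (0, 0) = 1" using B_inv(3) True by simp
    then have "B $$ (0, 0) * A $$ (0, 0) = 1"
      using A B_inv(1) True by (simp add: scalar_prod_def)
    then have "\<bar>B $$ (0, 0)\<bar> * \<bar>A $$ (0, 0)\<bar> = 1" by (metis abs_mult abs_one)
    then have "2 \<le> \<bar>A $$ (0, 0)\<bar>"
      using B0 mult_right_mono[of "\<bar>B $$ (0, 0)\<bar>" "1 / 2" "\<bar>A $$ (0, 0)\<bar>"] by simp
    also have "A $$ (0, 0) = of_int (A' $$ (0, 0)) / of_int dA"
      using A' True unfolding AA' by simp
    also have "\<bar>\<dots>\<bar> \<le> \<bar>of_int (A' $$ (0, 0))\<bar>"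
      using dA divide_left_mono[of 1 "of_int dA" "\<bar>of_int (A' $$ (0, 0)) :: real\<bar>"] by simp
    also have "\<dots> \<le> of_int L"
      using data_size_ge(2)[of 0 A' 0 dA b' db] A' True unfolding L_def by (simp flip: of_int_abs)
    finally show ?thesis using True by simp
  qed
  have iter: "real k \<le> 1 / ln 2 * (real n)\<^sup>2 * ln (real n * of_int L)" if "k \<le> n" for k
  proof -
    have "real k \<le> real n * 1" using that by simp
    also have "\<dots> \<le> real n * real n" using n by (intro mult_left_mono) auto
    also have "\<dots> = 1 / ln 2 * (real n)\<^sup>2 * ln 2" by (simp add: power2_eq_square)
    also have "\<dots> \<le> 1 / ln 2 * (real n)\<^sup>2 * ln (real n * of_int L)"
      using size by (intro mult_left_mono) auto
    finally show ?thesis .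
  qed
  \<comment> \<open>A solution exists because some run terminates; the all-ones start is an
    arbitrary choice. By uniqueness every other start returns the same \<open>x\<close>.\<close>
  obtain k0 x where "gnm_run A b (vec n (\<lambda>_. 1)) k0 x"
    using gnm_run_exists[OF b sign_vecs_nonempty] by blast
  then have x: "is_ave_solution A b x"
    by (rule gnm_run_returns_solution[OF _ A b sign_vecs_nonempty])
  show "\<exists>x. {y. is_ave_solution A b y} = {x} \<and>
      (\<forall>z\<in>sign_vecs n. \<exists>k. gnm_run A b z k x \<and>
        real k \<le> 1 / ln 2 * (real n)\<^sup>2 * ln (real n * of_int (data_size A' dA b' db)))"
  proof (intro exI[of _ x] conjI ballI)
    show "{y. is_ave_solution A b y} = {x}" using x ave_solution_unique[OF b] by blast
    fix z assume z: "z \<in> sign_vecs n"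
    obtain k y where "k \<le> n" and run: "gnm_run A b z k y" using gnm_run_exists[OF b z] by blast
    moreover have "y = x"
      using ave_solution_unique[OF b gnm_run_returns_solution[OF run A b z] x] .
    ultimately show "\<exists>k. gnm_run A b z k x \<and>
        real k \<le> 1 / ln 2 * (real n)\<^sup>2 * ln (real n * of_int (data_size A' dA b' db))"
      using iter unfolding L_def by blast
  qed
qed

end
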